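(* There exists a single-pass streaming algorithm that, given a multi-armed bandit instance with $K$ arms arriving in a stream and fixed parameters $T$, $K$ with $T>K$, performs $T$ arm pulls with expected regret $\mathbb{E}[R_T]\leq O(K^{1/3}T^{2/3})$ and uses a memory of $\lceil\log^*(K)\rceil+1$ arms.
   Context: Single-pass streaming multi-armed bandits: there are $K$ arms, each with an unknown reward distribution (supported on $[0,1]$) with mean $\mu_i$; $\mu^*=\max_i\mu_i$. The arms arrive one by one in a stream in an arbitrary order. The algorithm may only pull arms currently stored in its memory (including the arm currently being read); once an arm is not stored or is discarded, it can never be retrieved. A memory of $m$ arms means at most $m$ arms are stored at any time. The algorithm performs $T$ arm pulls; if $a_1,\dots,a_T$ are the arms pulled, the regret is $R_T=T\mu^*-\sum_{s=1}^T\mu_{a_s}$ and $\mathbb{E}[R_T]$ is its expectation. $\log^*$ denotes the iterated logarithm; $O(\cdot)$ hides an absolute constant. *)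

theory Defs
  imports "HOL-Probability.Probability"
begin

definition log_star :: "real \<Rightarrow> nat" where
  "log_star x = (LEAST i. ((\<lambda>y. log 2 y) ^^ i) x \<le> 1)"

text \<open>Streaming algorithm model.  Arms are identified by their stream position j < K.
  An algorithm is a function alg s h: given its random seed s and the list h of rewards
  observed so far, it returns (a, M): the arm a pulled in the current step and the set M of
  arms stored in memory at that moment (after discarding/reading, before the pull).
  Rewards come from a reward table w: the n-th pull of arm j returns w (j, n).\<close>
fun run :: "(real \<Rightarrow> real list \<Rightarrow> nat \<times> nat set) \<Rightarrow> (nat \<times> nat \<Rightarrow> real) \<Rightarrow> real \<Rightarrow> nat
            \<Rightarrow> (nat \<times> nat set \<times> real) list" where
  "run alg w s 0 = []"
| "run alg w s (Suc t) =
     (let h = run alg w s t in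
      case alg s (map (\<lambda>x. snd (snd x)) h) of
        (a, M) \<Rightarrow> h @ [(a, M, w (a, length (filter (\<lambda>x. fst x = a) h)))])"

text \<open>Single-pass memory constraint with memory of m arms: in step t the stored set is a subset
  of the arms, has at most m elements, contains the pulled arm, and every stored arm was
  either stored in the previous step, or is a new arm coming later in the stream than every
  arm ever stored before (discarded / passed arms can never be retrieved).\<close>
definition mem_feasible :: "nat \<Rightarrow> nat \<Rightarrow> (nat \<times> nat set) list \<Rightarrow> bool" where
  "mem_feasible m K st \<longleftrightarrow>
     (\<forall>t<length st.
        let a = fst (st ! t); M = snd (st ! t);
            Mp = (if t = 0 then {} else snd (st ! (t - 1)));
            seen = (\<Union>i<t. snd (st ! i))
        in M \<subseteq> {..<K} \<and> card M \<le> m \<and> a \<in> M \<and> (\<forall>j\<in>M. j \<in> Mp \<or> (\<forall>i\<in>seen. i < j)))"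

definition bandit_instance :: "nat \<Rightarrow> (nat \<Rightarrow> real measure) \<Rightarrow> bool" where
  "bandit_instance K D \<longleftrightarrow>
     (\<forall>j<K. prob_space (D j) \<and> sets (D j) = sets borel \<and> (AE x in D j. 0 \<le> x \<and> x \<le> 1))"

definition arm_mean :: "(nat \<Rightarrow> real measure) \<Rightarrow> nat \<Rightarrow> real" where
  "arm_mean D j = (\<integral>x. x \<partial>D j)"

definition opt_mean :: "nat \<Rightarrow> (nat \<Rightarrow> real measure) \<Rightarrow> real" where
  "opt_mean K D = Max (arm_mean D ` {..<K})"

text \<open>Probability space: independent reward table (entry (j,n) distributed as D j) times a
  uniform random seed in [0,1] for the algorithm's internal randomness.\<close>
definition reward_space :: "nat \<Rightarrow> (nat \<Rightarrow> real measure) \<Rightarrow> ((nat \<times> nat \<Rightarrow> real) \<times> real) measure" where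
  "reward_space K D =
     (PiM ({..<K} \<times> UNIV) (\<lambda>p. D (fst p))) \<Otimes>\<^sub>M uniform_measure lborel {0..1::real}"

definition regret :: "nat \<Rightarrow> nat \<Rightarrow> (nat \<Rightarrow> real measure) \<Rightarrow> (real \<Rightarrow> real list \<Rightarrow> nat \<times> nat set)
                      \<Rightarrow> (nat \<times> nat \<Rightarrow> real) \<times> real \<Rightarrow> real" where
  "regret K T D alg = (\<lambda>(w, s). real T * opt_mean K D
                         - (\<Sum>t<T. arm_mean D (fst (run alg w s T ! t))))"

end

theory Submission
  imports Defs
begin

text \<open>
  The arms play a tournament with nested batches of \<open>N 0 = 1\<close>, \<open>N 1\<close>, \<open>N 2\<close>, and so on, consecutive arms,
  where \<open>N l = 8\<^sup>l\<close> times a power tower of height \<open>l\<close>. The winner of a level \<open>l\<close> batch is pulled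
  \<open>s l = 4\<^sup>l\<^sup>+\<^sup>2 m\<close> times the tower, with \<open>m\<close> about \<open>(T/K)\<^sup>2\<^sup>/\<^sup>3\<close>, and the best empirical mean within
  a level \<open>l + 1\<close> batch is promoted. Only one champion per level must be stored, and a batch contains
  all arms once the level reaches \<open>log\<^sup>* K\<close>. Since \<open>s l / N l\<close> decays like \<open>2\<^sup>-\<^sup>l\<close>, exploration costs
  \<open>O(K m)\<close> pulls. Following the batches that contain the best arm, level \<open>l\<close> loses at most twice the
  maximal deviation over the batch of size \<open>N (l + 1)\<close>; as \<open>ln (N (l + 1))\<close> is of the order of the
  tower of height \<open>l\<close>, a union bound over all arms of the batch, winners or not, gives an expected
  deviation \<open>O(2\<^sup>-\<^sup>l / sqrt m)\<close>, summing to \<open>O(1 / sqrt m)\<close>. The number of pulls spent on a surviving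
  arm depends only on its level, so the schedule is deterministic and each empirical mean is an
  average over fixed entries of the reward table; hence no conditioning is needed.
\<close>

section \<open>The tournament strategy\<close>

datatype state = State (cur: nat) (acc: real) (champ: "nat \<Rightarrow> nat option") (score: "nat \<Rightarrow> real")

text \<open>Batch sizes and pull counts stay abstract: schedule, memory and regret decomposition
  rest only on nested batches and on a top level that covers the whole stream.\<close>

locale tournament =
  fixes K L :: nat and N s :: "nat \<Rightarrow> nat"
  assumes K_pos: "0 < K"
    and N_0: "N 0 = 1"
    and N_pos: "0 < N l"
    and N_dvd: "N l dvd N (Suc l)"
    and s_pos: "0 < s l"
    and K_le_N: "K \<le> N L"
begin

text \<open>The end of the stream closes the running batch of every level, so incomplete last
  batches also produce a winner.\<close>

definition ends :: "nat \<Rightarrow> nat \<Rightarrow> bool" where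
  "ends l j \<longleftrightarrow> N l dvd Suc j \<or> Suc j = K"

text \<open>Position \<open>(j, l, k)\<close>: arm \<open>j\<close> is the last one read, the current arm won its level \<open>l\<close> batch
  and has been pulled \<open>k\<close> times at this level. The \<open>champ\<close> of index \<open>l\<close> leads among the level \<open>l\<close>
  winners of the running level \<open>l + 1\<close> batch. Level \<open>L\<close> is the commitment phase and never ends.\<close>
fun advance :: "nat \<times> nat \<times> nat \<Rightarrow> nat \<times> nat \<times> nat" where
  "advance (j, l, k) =
     (if L \<le> l \<or> Suc k < s l then (j, l, Suc k)
      else if ends (Suc l) j then (j, Suc l, 0)
      else (Suc j, 0, 0))"

primrec pos :: "nat \<Rightarrow> nat \<times> nat \<times> nat" where
  "pos 0 = (0, 0, 0)"
| "pos (Suc t) = advance (pos t)"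

text \<open>The number of pulls an arm has received when it enters level \<open>l\<close>, hence the
  first index of its reward-table row that is still unread.\<close>

definition offset :: "nat \<Rightarrow> nat" where
  "offset l = sum s {..<l}"

fun slot :: "nat \<times> nat \<times> nat \<Rightarrow> nat" where
  "slot (j, l, k) = offset l + k"

text \<open>All level \<open>l\<close> winners receive \<open>s l\<close> pulls, so comparing reward
  sums is comparing empirical means; ties keep the earlier champion. A score without a champion is
  stale and never consulted.\<close>

fun step :: "nat \<times> nat \<times> nat \<Rightarrow> state \<Rightarrow> real \<Rightarrow> state" where
  "step (j, l, k) \<sigma> r =
     (let x = acc \<sigma> + r in
      if L \<le> l \<or> Suc k < s l then State (cur \<sigma>) x (champ \<sigma>) (score \<sigma>)
      else
        let keep = (champ \<sigma> l \<noteq> None \<and> x \<le> score \<sigma> l);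
            c = (if keep then the (champ \<sigma> l) else cur \<sigma>);
            y = (if keep then score \<sigma> l else x)
        in if ends (Suc l) j then State c 0 ((champ \<sigma>)(l := None)) (score \<sigma>)
           else State (Suc j) 0 ((champ \<sigma>)(l := Some c)) ((score \<sigma>)(l := y)))"

definition init :: state where
  "init = State 0 0 (\<lambda>_. None) (\<lambda>_. 0)"

primrec replay :: "(nat \<Rightarrow> real) \<Rightarrow> nat \<Rightarrow> state" where
  "replay r 0 = init"
| "replay r (Suc t) = step (pos t) (replay r t) (r t)"

definition stored :: "state \<Rightarrow> nat set" where
  "stored \<sigma> = insert (cur \<sigma>) {d. \<exists>l<L. champ \<sigma> l = Some d}"

definition strategy :: "real \<Rightarrow> real list \<Rightarrow> nat \<times> nat set" where
  "strategy u h = (let \<sigma> = replay (\<lambda>i. h ! i) (length h) in (cur \<sigma>, stored \<sigma>))"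

text \<open>The same evolution driven by the reward table. Entries are read at the scheduled index
  \<open>slot (pos t)\<close> instead of a pull count; \<open>run_strategy\<close> shows that the
  two agree.\<close>

primrec state :: "(nat \<times> nat \<Rightarrow> real) \<Rightarrow> nat \<Rightarrow> state" where
  "state w 0 = init"
| "state w (Suc t) = step (pos t) (state w t) (w (cur (state w t), slot (pos t)))"

definition pulls :: "(nat \<times> nat \<Rightarrow> real) \<Rightarrow> nat \<Rightarrow> nat \<Rightarrow> nat" where
  "pulls w t a = length (filter (\<lambda>i. cur (state w i) = a) [0..<t])"

section \<open>Nested batches and the deterministic schedule\<close>

lemma pulls_simps [simp]:
  "pulls w 0 a = 0"
  "pulls w (Suc t) a = pulls w t a + (if cur (state w t) = a then 1 else 0)"
  by (auto simp: pulls_def)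

lemma N_dvd_mono: "l \<le> l' \<Longrightarrow> N l dvd N l'"
  by (induction l' rule: nat_induct) (auto simp: le_Suc_eq intro: dvd_trans N_dvd)

lemma ends_0 [simp]: "ends 0 j"
  by (simp add: ends_def N_0)

text \<open>A positive multiple of \<open>N L\<close> is at least \<open>K\<close>, so from level
  \<open>L\<close> on only the end of the stream closes a batch.\<close>

lemma ends_last: "ends l j \<Longrightarrow> j < K \<Longrightarrow> L \<le> l \<Longrightarrow> Suc j = K"
  unfolding ends_def
proof (elim disjE)
  assume "j < K" "L \<le> l" "N l dvd Suc j"
  then have "N L \<le> Suc j"
    by (meson N_dvd_mono dvd_imp_le dvd_trans zero_less_Suc)
  then show "Suc j = K"
    using \<open>j < K\<close> K_le_N by simp
qed

lemma Suc_div_not_ends: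
  assumes "\<not> ends l j" "l \<le> l'"
  shows "Suc j div N l' = j div N l'"
proof -
  have "\<not> N l' dvd Suc j"
    using assms N_dvd_mono dvd_trans unfolding ends_def by blast
  then show ?thesis
    by (simp add: div_Suc dvd_eq_mod_eq_0)
qed

lemma div_eq_mono:
  assumes "i div N l = j div N l" "l \<le> l'"
  shows "i div N l' = j div N l'"
proof -
  obtain q where "N l' = N l * q"
    using N_dvd_mono[OF assms(2)] by (auto elim: dvdE)
  then show ?thesis
    using assms(1) by (simp add: div_mult2_eq)
qed

lemma pos_valid:
  assumes "pos t = (j, l, k)"
  shows "j < K \<and> l \<le> L \<and> ends l j \<and> (l < L \<longrightarrow> k < s l)"
  using assms
proof (induction t arbitrary: j l k)
  case 0
  then show ?case using K_pos s_pos by auto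
next
  case (Suc t)
  obtain j' l' k' where p: "pos t = (j', l', k')"
    by (cases "pos t")
  \<comment> \<open>A batch left open rules out \<open>Suc j' = K\<close>, so there is a next arm to
    read.\<close>
  have "Suc j' < K" if "\<not> ends (Suc l') j'"
    using that Suc.IH[OF p] by (auto simp: ends_def)
  then show ?case
    using Suc.prems Suc.IH[OF p] p s_pos by (auto split: if_splits)
qed

section \<open>Pull counts and stored sums along the schedule\<close>

definition invariant :: "(nat \<times> nat \<Rightarrow> real) \<Rightarrow> nat \<Rightarrow> bool" where
  "invariant w t \<longleftrightarrow> (case pos t of (j, l, k) \<Rightarrow> let \<sigma> = state w t in
     cur \<sigma> \<le> j \<and> cur \<sigma> div N l = j div N l \<and> pulls w t (cur \<sigma>) = offset l + k \<and>
     (l < L \<longrightarrow> acc \<sigma> = (\<Sum>n<k. w (cur \<sigma>, offset l + n))) \<and>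
     (\<forall>l' d. champ \<sigma> l' = Some d \<longrightarrow>
        l \<le> l' \<and> l' < L \<and> d \<le> j \<and> d div N (Suc l') = j div N (Suc l') \<and>
        pulls w t d = offset (Suc l') \<and>
        score \<sigma> l' = (\<Sum>n<s l'. w (d, offset l' + n))) \<and>
     (\<forall>a>j. pulls w t a = 0))"

lemma offset_Suc: "offset (Suc l) = offset l + s l"
  by (simp add: offset_def)

lemma offset_mono: "l \<le> l' \<Longrightarrow> offset l \<le> offset l'"
  unfolding offset_def by (intro sum_mono2) auto

text \<open>The decisive clauses fix the pull count of every stored arm by its level alone and give
  unread arms count zero. So the sums in \<open>acc\<close> and \<open>score\<close> range over
  table entries known in advance.\<close>

lemma invariant: "invariant w t"
proof (induction t)
  case 0
  then show ?case
    by (auto simp: invariant_def init_def offset_def)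
next
  case (Suc t)
  obtain j l k where p: "pos t = (j, l, k)"
    by (cases "pos t")
  define \<sigma> where "\<sigma> = state w t"
  define x where "x = acc \<sigma> + w (cur \<sigma>, offset l + k)"
  define c where "c = (if champ \<sigma> l \<noteq> None \<and> x \<le> score \<sigma> l then the (champ \<sigma> l) else cur \<sigma>)"
  define y where "y = (if champ \<sigma> l \<noteq> None \<and> x \<le> score \<sigma> l then score \<sigma> l else x)"
  note pv = pos_valid[OF p]
  have cur: "cur \<sigma> \<le> j" "cur \<sigma> div N l = j div N l" "pulls w t (cur \<sigma>) = offset l + k"
      "l < L \<Longrightarrow> acc \<sigma> = (\<Sum>n<k. w (cur \<sigma>, offset l + n))"
    and ch: "\<And>l' d. champ \<sigma> l' = Some d \<Longrightarrow>
        l \<le> l' \<and> l' < L \<and> d \<le> j \<and> d div N (Suc l') = j div N (Suc l') \<and>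
        pulls w t d = offset (Suc l') \<and>
        score \<sigma> l' = (\<Sum>n<s l'. w (d, offset l' + n))"
    and new: "\<And>a. j < a \<Longrightarrow> pulls w t a = 0"
    using Suc.IH[unfolded invariant_def p prod.case Let_def, folded \<sigma>_def] by blast+
  \<comment> \<open>Pull counts separate the two: the current arm has fewer than
    \<open>offset (Suc l)\<close> pulls, a champion of index \<open>l' \<ge> l\<close> has at least
    that many. Hence the next pull changes no champion's count.\<close>
  have dist: "d \<noteq> cur \<sigma>" if "champ \<sigma> l' = Some d" for l' d
  proof
    assume "d = cur \<sigma>"
    then have "offset (Suc l') = offset l + k" "l \<le> l'" "l' < L"
      using ch[OF that] cur by auto
    moreover have "offset (Suc l) \<le> offset (Suc l')"
      using \<open>l \<le> l'\<close> by (intro offset_mono) auto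
    moreover have "k < s l" using pv \<open>l \<le> l'\<close> \<open>l' < L\<close> by auto
    ultimately show False by (simp add: offset_Suc)
  qed
  have pulls': "pulls w (Suc t) d = pulls w t d" if "champ \<sigma> l' = Some d" for l' d
    using dist[OF that] by (auto simp: \<sigma>_def)
  have new': "pulls w (Suc t) a = 0" if "j < a" for a
    using new[OF that] cur(1) that by (auto simp: \<sigma>_def)
  have pcur: "pulls w (Suc t) (cur \<sigma>) = offset l + Suc k"
    using cur(3) by (simp add: \<sigma>_def)
  have x_eq: "x = (\<Sum>n<Suc k. w (cur \<sigma>, offset l + n))" if "l < L"
    using cur(4)[OF that] by (simp add: x_def)
  show ?case
  proof (cases "L \<le> l \<or> Suc k < s l")
    case True
    then have p': "pos (Suc t) = (j, l, Suc k)"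
      and \<sigma>': "state w (Suc t) = State (cur \<sigma>) x (champ \<sigma>) (score \<sigma>)"
      using p by (auto simp: \<sigma>_def x_def Let_def)
    show ?thesis
      unfolding invariant_def p' \<sigma>' prod.case Let_def state.sel
      using cur(1,2) pcur x_eq new' pulls' ch by auto
  next
    case False
    then have k: "s l = Suc k" "l < L" using pv by auto
    have y_eq: "y = (\<Sum>n<s l. w (c, offset l + n))"
      using ch[of l] x_eq k by (auto simp: y_def c_def)
    have c: "c \<le> j" "c div N (Suc l) = j div N (Suc l)" "pulls w (Suc t) c = offset (Suc l)"
      using ch[of l] cur pulls'[of l] pcur k div_eq_mono[OF cur(2), of "Suc l"]
      by (auto simp: c_def offset_Suc simp del: pulls_simps)
    show ?thesis
    proof (cases "ends (Suc l) j")
      case True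
      then have p': "pos (Suc t) = (j, Suc l, 0)"
        and \<sigma>': "state w (Suc t) = State c 0 ((champ \<sigma>)(l := None)) (score \<sigma>)"
        using p False by (auto simp: \<sigma>_def x_def c_def Let_def)
      have "Suc l \<le> l'" if "l' \<noteq> l" "champ \<sigma> l' = Some d" for l' d
        using ch[OF that(2)] that(1) by auto
      then show ?thesis
        unfolding invariant_def p' \<sigma>' prod.case Let_def state.sel
        using c new' pulls' ch by (auto split: if_splits simp del: pulls_simps)
    next
      case False
      then have p': "pos (Suc t) = (Suc j, 0, 0)"
        and \<sigma>': "state w (Suc t) = State (Suc j) 0 ((champ \<sigma>)(l := Some c)) ((score \<sigma>)(l := y))"
        using p k by (auto simp: \<sigma>_def x_def c_def y_def Let_def)
      \<comment> \<open>Batches are nested: where the level \<open>Suc l\<close> batch stays open,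
        so do all larger ones, and the next arm lies in the same batches as
        \<open>j\<close>.\<close>
      have blk: "Suc j div N (Suc l') = j div N (Suc l')" if "l \<le> l'" for l'
        using Suc_div_not_ends[OF False, of "Suc l'"] that by simp
      show ?thesis
        unfolding invariant_def p' \<sigma>' prod.case Let_def state.sel
        using c new' pulls' ch blk y_eq k(2)
        by (auto simp: offset_def le_Suc_eq simp del: pulls_simps dest!: ch split: if_splits)
    qed
  qed
qed

section \<open>Agreement with the streaming model and the memory bound\<close>

lemma replay_cong: "(\<And>i. i < t \<Longrightarrow> r i = r' i) \<Longrightarrow> replay r t = replay r' t"
  by (induction t) auto

lemma state_replay: "state w t = replay (\<lambda>i. w (cur (state w i), slot (pos i))) t"
  by (induction t) auto

text \<open>\<open>run\<close> indexes the table by the number of earlier pulls of the chosen arm,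
  which the invariant identifies with \<open>slot (pos t)\<close>.\<close>

lemma run_strategy:
  "run strategy w u t =
     map (\<lambda>i. (cur (state w i), stored (state w i), w (cur (state w i), slot (pos i)))) [0..<t]"
proof (induction t)
  case (Suc t)
  define h where "h = map (\<lambda>i. w (cur (state w i), slot (pos i))) [0..<t]"
  have "replay (\<lambda>i. h ! i) (length h) = state w t"
    unfolding state_replay[of w t] by (auto simp: h_def intro!: replay_cong)
  moreover have "pulls w t (cur (state w t)) = slot (pos t)"
    using invariant[of w t] by (cases "pos t") (simp add: invariant_def Let_def)
  then have "length (filter (\<lambda>x. fst x = cur (state w t)) (run strategy w u t)) = slot (pos t)"
    by (simp add: Suc.IH pulls_def filter_map comp_def)
  ultimately show ?case
    using Suc.IH by (simp add: strategy_def Let_def comp_def h_def)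
qed simp

lemma phase_mono: "t \<le> t' \<Longrightarrow> fst (pos t) \<le> fst (pos t')"
proof (induction t' rule: nat_induct)
  case (Suc t')
  have "fst (pos t') \<le> fst (pos (Suc t'))"
    by (cases "pos t'") auto
  with Suc show ?case by (auto simp: le_Suc_eq)
qed simp

lemma stored_le_phase: "d \<in> stored (state w t) \<Longrightarrow> d \<le> fst (pos t)"
  using invariant[of w t] by (cases "pos t") (auto simp: invariant_def Let_def stored_def)

lemma stored_Suc:
  assumes "d \<in> stored (state w (Suc t))"
  shows "d \<in> stored (state w t) \<or> d = Suc (fst (pos t))"
  using assms
  by (cases "pos t") (auto simp: stored_def Let_def not_le split: if_splits)

lemma card_stored: "card (stored \<sigma>) \<le> L + 1"
proof -
  have "{d. \<exists>l<L. champ \<sigma> l = Some d} \<subseteq> (\<lambda>l. the (champ \<sigma> l)) ` {..<L}"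
    by force
  then have "card {d. \<exists>l<L. champ \<sigma> l = Some d} \<le> L"
    using surj_card_le[of "{..<L}"] by simp
  then show ?thesis
    unfolding stored_def using card_insert_le_m1[of "L + 1"]
    by (metis add_diff_cancel_right' add_gr_0 less_one)
qed

lemma strategy_feasible:
  assumes "L + 1 \<le> m"
  shows "mem_feasible m K (map (\<lambda>x. (fst x, fst (snd x))) (run strategy w u T))"
  unfolding mem_feasible_def Let_def
proof (intro allI impI conjI)
  let ?st = "map (\<lambda>x. (fst x, fst (snd x))) (run strategy w u T)"
  fix t assume "t < length ?st"
  then have t: "t < T"
    by (simp add: run_strategy)
  have st: "?st ! i = (cur (state w i), stored (state w i))" if "i \<le> t" for i
    using that t by (simp add: run_strategy)
  have "fst (pos t) < K"
    using pos_valid[of t] by (cases "pos t") auto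
  then show "snd (?st ! t) \<subseteq> {..<K}"
    using stored_le_phase[of _ w t] by (auto simp: st intro: le_less_trans)
  show "card (snd (?st ! t)) \<le> m"
    using card_stored[of "state w t"] assms by (simp add: st)
  show "fst (?st ! t) \<in> snd (?st ! t)"
    by (simp add: st stored_def)
  show "\<forall>j\<in>snd (?st ! t). j \<in> (if t = 0 then {} else snd (?st ! (t - 1))) \<or>
          (\<forall>i\<in>\<Union>i<t. snd (?st ! i). i < j)"
  proof (cases t)
    case (Suc t')
    \<comment> \<open>Everything stored so far has index at most the last arm read, so the single
      arm that can enter memory comes later than all arms seen.\<close>
    have "i < Suc (fst (pos t'))" if "i \<in> stored (state w q)" "q < t" for i q
      using stored_le_phase[OF that(1)] phase_mono[of q t'] that(2) Suc by auto
    then show ?thesis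
      using stored_Suc[of _ w t'] by (fastforce simp: st Suc)
  qed simp
qed

section \<open>Near-optimality of the arm that is committed to\<close>

lemma winner_near_optimal:
  fixes \<mu> \<delta> :: "nat \<Rightarrow> real"
  assumes "best < K"
    and dev: "\<And>l d. l < L \<Longrightarrow> d < K \<Longrightarrow> d div N (Suc l) = best div N (Suc l) \<Longrightarrow>
        \<bar>(\<Sum>n<s l. w (d, offset l + n)) - real (s l) * \<mu> d\<bar> \<le> real (s l) * \<delta> l"
    and "pos t = (j, L, k)"
  shows "\<mu> best - (\<Sum>l<L. 2 * \<delta> l) \<le> \<mu> (cur (state w t))"
proof -
  \<comment> \<open>The mean guaranteed for the winner of the level \<open>l\<close> batch
    containing \<open>best\<close>. Each level loses \<open>\<delta> l\<close> twice: once from the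
    mean of a good contender to its score, once from the winning score back to the winner's
    mean.\<close>
  define thr where "thr l = \<mu> best - (\<Sum>i<l. 2 * \<delta> i)" for l
  have thr_Suc: "thr (Suc l) = thr l - 2 * \<delta> l" for l
    by (simp add: thr_def)
  \<comment> \<open>Once \<open>best\<close> has been read, its claim is carried either by the
    current arm, through its mean, or by a stored champion, through its score.\<close>
  have Q: "best \<le> j \<Longrightarrow>
      (best div N l = j div N l \<and> thr l \<le> \<mu> (cur (state w t))) \<or>
      (\<exists>l' d. l \<le> l' \<and> l' < L \<and> best div N (Suc l') = j div N (Suc l') \<and>
         champ (state w t) l' = Some d \<and> real (s l') * (thr l' - \<delta> l') \<le> score (state w t) l')"
    if "pos t = (j, l, k)" for t j l k
    using that
  proof (induction t arbitrary: j l k)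
    case 0
    then show ?case by (auto simp: init_def thr_def)
  next
    case (Suc t)
    obtain j l k where p: "pos t = (j, l, k)"
      by (cases "pos t")
    define \<sigma> where "\<sigma> = state w t"
    define x where "x = acc \<sigma> + w (cur \<sigma>, offset l + k)"
    define c where "c = (if champ \<sigma> l \<noteq> None \<and> x \<le> score \<sigma> l then the (champ \<sigma> l) else cur \<sigma>)"
    define y where "y = (if champ \<sigma> l \<noteq> None \<and> x \<le> score \<sigma> l then score \<sigma> l else x)"
    note pv = pos_valid[OF p]
    note I = invariant[of w t, unfolded invariant_def p prod.case Let_def, folded \<sigma>_def]
    note IH = Suc.IH[OF _ p, folded \<sigma>_def]
    show ?case
    proof (cases "L \<le> l \<or> Suc k < s l")
      case True
      then show ?thesis
        using Suc.prems IH p by (auto simp: Let_def \<sigma>_def)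
    next
      case False
      then have k: "s l = Suc k" "l < L" using pv by auto
      have x_eq: "x = (\<Sum>n<s l. w (cur \<sigma>, offset l + n))"
        using I k by (simp add: x_def)
      have y_eq: "y = (\<Sum>n<s l. w (c, offset l + n))"
        using I x_eq by (auto simp: y_def c_def)
      have blk: "c div N (Suc l) = j div N (Suc l)" "cur \<sigma> div N (Suc l) = j div N (Suc l)"
        using I div_eq_mono[of "cur \<sigma>" l j "Suc l"] by (auto simp: c_def)
      have "c \<le> j" "cur \<sigma> \<le> j"
        using I by (auto simp: c_def)
      then have lt: "c < K" "cur \<sigma> < K"
        using pv by auto
      have yx: "x \<le> y" and ysc: "champ \<sigma> l = Some d \<Longrightarrow> score \<sigma> l \<le> y" for d
        by (auto simp: y_def)
      \<comment> \<open>The level \<open>l\<close> pulls are complete: a claim carried by the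
        current arm, or by the champion of index \<open>l\<close>, passes to the score
        \<open>y\<close> of the better of the two. Claims at higher indices are untouched.\<close>
      have dich: "(best div N (Suc l) = j div N (Suc l) \<and> real (s l) * (thr l - \<delta> l) \<le> y) \<or>
         (\<exists>l' d. Suc l \<le> l' \<and> l' < L \<and> best div N (Suc l') = j div N (Suc l') \<and>
           champ \<sigma> l' = Some d \<and> real (s l') * (thr l' - \<delta> l') \<le> score \<sigma> l')"
        if "best \<le> j"
        using IH[OF that]
      proof (elim disjE conjE exE)
        assume b: "best div N l = j div N l" "thr l \<le> \<mu> (cur \<sigma>)"
        have b': "best div N (Suc l) = j div N (Suc l)"
          using div_eq_mono[OF b(1)] by simp
        have "real (s l) * thr l \<le> real (s l) * \<mu> (cur \<sigma>)"
          using b(2) by (intro mult_left_mono) auto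
        then have "real (s l) * (thr l - \<delta> l) \<le> x"
          using dev[OF k(2) lt(2)] b' blk(2) x_eq by (auto simp: algebra_simps)
        then show ?thesis using b' yx by auto
      next
        fix l' d assume *: "l \<le> l'" "l' < L" "best div N (Suc l') = j div N (Suc l')"
           "champ \<sigma> l' = Some d" "real (s l') * (thr l' - \<delta> l') \<le> score \<sigma> l'"
        show ?thesis
        proof (cases "l' = l")
          case True
          then show ?thesis using * ysc by fastforce
        next
          case False
          then have "Suc l \<le> l'" using * by simp
          then show ?thesis using * by blast
        qed
      qed
      show ?thesis
      proof (cases "ends (Suc l) j")
        case True
        then have p': "pos (Suc t) = (j, Suc l, 0)"
          and \<sigma>': "state w (Suc t) = State c 0 ((champ \<sigma>)(l := None)) (score \<sigma>)"
          using p False by (auto simp: \<sigma>_def x_def c_def Let_def)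
        \<comment> \<open>The batch closes, and the second deviation bound turns the score
          \<open>y\<close> back into a mean.\<close>
        have "thr (Suc l) \<le> \<mu> c"
          if "best div N (Suc l) = j div N (Suc l)" "real (s l) * (thr l - \<delta> l) \<le> y"
        proof -
          have "y \<le> real (s l) * (\<mu> c + \<delta> l)"
            using dev[OF k(2) lt(1)] blk(1) that(1) y_eq by (auto simp: algebra_simps)
          then have "real (s l) * (thr l - \<delta> l) \<le> real (s l) * (\<mu> c + \<delta> l)"
            using that(2) by simp
          then show ?thesis
            using s_pos[of l] by (simp add: thr_Suc)
        qed
        then show ?thesis
          using Suc.prems dich unfolding p' \<sigma>' state.sel by fastforce
      next
        case False
        then have p': "pos (Suc t) = (Suc j, 0, 0)"
          and \<sigma>': "state w (Suc t) = State (Suc j) 0 ((champ \<sigma>)(l := Some c)) ((score \<sigma>)(l := y))"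
          using p k by (auto simp: \<sigma>_def x_def c_def y_def Let_def)
        have blk': "Suc j div N (Suc l') = j div N (Suc l')" if "l \<le> l'" for l'
          using Suc_div_not_ends[OF False, of "Suc l'"] that by simp
        have "\<exists>l' d. l' < L \<and> best div N (Suc l') = Suc j div N (Suc l') \<and>
           ((champ \<sigma>)(l := Some c)) l' = Some d \<and>
           real (s l') * (thr l' - \<delta> l') \<le> ((score \<sigma>)(l := y)) l'" if "best \<le> j"
          using dich[OF that]
        proof (elim disjE conjE exE)
          assume "best div N (Suc l) = j div N (Suc l)" "real (s l) * (thr l - \<delta> l) \<le> y"
          then show ?thesis
            using k(2) blk'[of l] by (intro exI[of _ l] exI[of _ c]) auto
        next
          fix l' d assume "Suc l \<le> l'" "l' < L" "best div N (Suc l') = j div N (Suc l')"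
            "champ \<sigma> l' = Some d" "real (s l') * (thr l' - \<delta> l') \<le> score \<sigma> l'"
          then show ?thesis
            using blk'[of l'] by (intro exI[of _ l'] exI[of _ d]) auto
        qed
        \<comment> \<open>If \<open>best\<close> is the arm just read, it carries its own claim with
          \<open>thr 0 = \<mu> best\<close>; otherwise a champion does.\<close>
        then show ?thesis
          using Suc.prems unfolding p' \<sigma>' state.sel
          by (cases "best = Suc j") (auto simp: thr_def)
      qed
    qed
  qed
  \<comment> \<open>At level \<open>L\<close> the stream is exhausted, so \<open>best\<close> has
    been read, and no champion index \<open>l'\<close> with \<open>L \<le> l' < L\<close> exists:
    the current arm carries the claim.\<close>
  have "Suc j = K"
    using pos_valid[OF assms(3)] ends_last[of L j] by auto
  then show ?thesis
    using Q[OF assms(3)] assms(1) by (auto simp: thr_def)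
qed

section \<open>Counting the exploration steps\<close>

lemma pos_inj: "inj pos"
proof -
  let ?R = "less_than <*lex*> less_than <*lex*> less_than :: ((nat \<times> nat \<times> nat) \<times> _) set"
  have "(pos t, pos (Suc t)) \<in> ?R" for t
    by (cases "pos t") auto
  moreover have "trans ?R" by (intro trans_lex_prod trans_less_than)
  ultimately have "(pos a, pos b) \<in> ?R" if "a < b" for a b
    using that
    by (induction b) (auto simp: less_Suc_eq intro: transD[OF \<open>trans ?R\<close>])
  moreover have "wf ?R" by (intro wf_lex_prod wf_less_than)
  ultimately show ?thesis
    by (intro linorder_injI) (metis wf_not_refl)
qed

definition exploring :: "nat \<Rightarrow> bool" where
  "exploring t \<longleftrightarrow> fst (snd (pos t)) < L"

text \<open>Positions increase lexicographically and never repeat, so exploration steps are counted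
  by positions: each closed level \<open>l\<close> batch has one winner, pulled at most
  \<open>s l\<close> times there.\<close>

lemma card_exploring:
  "card {t. t < T \<and> exploring t} \<le> (\<Sum>l<L. s l * card {j. j < K \<and> ends l j})"
proof -
  let ?B = "\<Union>l<L. {j. j < K \<and> ends l j} \<times> {l} \<times> {..<s l}"
  have "pos ` {t. t < T \<and> exploring t} \<subseteq> ?B"
  proof clarify
    fix t a b c assume "(a, b, c) = pos t" "exploring t"
    then show "(a, b, c) \<in> ?B"
      using pos_valid[of t a b c] by (auto simp: exploring_def dest!: sym[of _ "pos t"])
  qed
  moreover have "finite ?B" by auto
  ultimately have "card (pos ` {t. t < T \<and> exploring t}) \<le> card ?B"
    by (intro card_mono)
  moreover have "card (pos ` {t. t < T \<and> exploring t}) = card {t. t < T \<and> exploring t}"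
    by (intro card_image inj_on_subset[OF pos_inj]) auto
  moreover have "card ?B = (\<Sum>l<L. s l * card {j. j < K \<and> ends l j})"
    by (subst card_UN_disjoint) (auto simp: card_cartesian_product mult.commute)
  ultimately show ?thesis by simp
qed

text \<open>The extra one pays for the incomplete batch at the end of the stream.\<close>

lemma card_ends: "card {j. j < K \<and> ends l j} \<le> K div N l + 1"
proof -
  have "inj_on (\<lambda>j. Suc j div N l) {j. j < K \<and> N l dvd Suc j}"
    by (rule inj_onI) (auto simp: N_pos elim!: dvdE)
  moreover have "(\<lambda>j. Suc j div N l) ` {j. j < K \<and> N l dvd Suc j} \<subseteq> {1..K div N l}"
    using N_pos[of l]
    by (auto simp: div_le_mono Suc_le_eq div_greater_zero_iff dvd_imp_le)
  ultimately have "card {j. j < K \<and> N l dvd Suc j} \<le> K div N l"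
    using card_inj_on_le[of _ _ "{1..K div N l}"] by fastforce
  moreover have "{j. j < K \<and> ends l j} \<subseteq> insert (K - 1) {j. j < K \<and> N l dvd Suc j}"
    by (auto simp: ends_def)
  then have "card {j. j < K \<and> ends l j} \<le> card (insert (K - 1) {j. j < K \<and> N l dvd Suc j})"
    by (intro card_mono) auto
  ultimately show ?thesis
    using card_insert_le_m1[of "K div N l + 1" "{j. j < K \<and> N l dvd Suc j}" "K - 1"] by simp
qed

end

section \<open>Deviations in the reward table\<close>

definition table :: "nat \<Rightarrow> (nat \<Rightarrow> real measure) \<Rightarrow> (nat \<times> nat \<Rightarrow> real) measure" where
  "table K D = PiM ({..<K} \<times> UNIV) (\<lambda>p. D (fst p))"

lemma bandit_instanceD:
  assumes "bandit_instance K D" "j < K"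
  shows "prob_space (D j)" "sets (D j) = sets borel" "AE x in D j. x \<in> {0..1}"
  using assms by (auto simp: bandit_instance_def)

lemma prob_space_table: "bandit_instance K D \<Longrightarrow> prob_space (table K D)"
  unfolding table_def by (intro prob_space_PiM) (auto dest: bandit_instanceD)

lemma measurable_entry:
  assumes "bandit_instance K D"
  shows "(\<lambda>w. w p) \<in> borel_measurable (table K D)"
proof (cases "fst p < K")
  case True
  then have "(\<lambda>w. w p) \<in> measurable (table K D) (D (fst p))"
    unfolding table_def by (intro measurable_component_singleton) (auto simp: mem_Times_iff)
  then show ?thesis
    by (simp add: measurable_cong_sets[OF refl bandit_instanceD(2)[OF assms True]])
next
  case False
  \<comment> \<open>Outside the index set every point of the product space takes the value
    \<open>undefined\<close>, so the coordinate is constant.\<close>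
  then have "p \<notin> {..<K} \<times> UNIV"
    by (simp add: mem_Times_iff)
  then have "w p = undefined" if "w \<in> space (table K D)" for w
    using PiE_arb[OF that[unfolded table_def space_PiM]] by simp
  then have "(\<lambda>w. w p) \<in> borel_measurable (table K D) \<longleftrightarrow>
      (\<lambda>w. undefined :: real) \<in> borel_measurable (table K D)"
    by (rule measurable_cong)
  then show ?thesis by simp
qed

lemma arm_mean_bounds:
  assumes "bandit_instance K D" "j < K"
  shows "0 \<le> arm_mean D j" "arm_mean D j \<le> 1"
proof -
  interpret prob_space "D j" by (rule bandit_instanceD[OF assms])
  interpret interval_bounded_random_variable "D j" "\<lambda>x. x" 0 1
    using bandit_instanceD[OF assms] by unfold_locales (auto cong: measurable_cong_sets)
  show "0 \<le> arm_mean D j"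
    unfolding arm_mean_def by (rule integral_nonneg_AE) (use AE_in_interval in auto)
  have "arm_mean D j \<le> expectation (\<lambda>_. 1)"
    unfolding arm_mean_def by (rule integral_mono_AE) (use AE_in_interval integrable in auto)
  then show "arm_mean D j \<le> 1" by (simp add: prob_space)
qed

lemma arm_mean_le_opt:
  "j < K \<Longrightarrow> arm_mean D j \<le> opt_mean K D"
  unfolding opt_mean_def by (intro Max_ge) auto

lemma opt_mean_attained:
  assumes "0 < K"
  obtains best where "best < K" "arm_mean D best = opt_mean K D"
proof -
  have "opt_mean K D \<in> arm_mean D ` {..<K}"
    unfolding opt_mean_def using assms by (intro Max_in) auto
  then show ?thesis using that by auto
qed

section \<open>Exponential moments and the maximal deviation\<close>

lemma exp_moment_entry:
  assumes "bandit_instance K D" "j < K" "\<theta> \<noteq> 0"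
  shows "(\<integral>\<^sup>+x. ennreal (exp (\<theta> * (x - arm_mean D j))) \<partial>D j) \<le> ennreal (exp (\<theta>\<^sup>2 / 8))"
proof -
  interpret prob_space "D j" by (rule bandit_instanceD[OF assms(1,2)])
  note D = bandit_instanceD[OF assms(1,2)]
  show ?thesis
  proof (cases "\<theta> > 0")
    case True
    interpret interval_bounded_random_variable "D j" "\<lambda>x. x" 0 1
      using D by unfold_locales (auto cong: measurable_cong_sets)
    show ?thesis
      using Hoeffdings_lemma_nn_integral[OF True] by (simp add: arm_mean_def)
  next
    case False
    \<comment> \<open>Hoeffding's lemma wants a positive parameter, so a negative
      \<open>\<theta>\<close> is moved onto the reflected variable.\<close>
    interpret interval_bounded_random_variable "D j" "\<lambda>x. - x" "-1" 0
      using D by unfold_locales (auto cong: measurable_cong_sets)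
    have "expectation (\<lambda>x. - x) = - arm_mean D j"
      by (simp add: arm_mean_def)
    then show ?thesis
      using Hoeffdings_lemma_nn_integral[of "- \<theta>"] False assms(3)
      by (simp add: algebra_simps)
  qed
qed

text \<open>Only finitely many independent entries occur; projecting the infinite product onto them
  lets the moment factorise into single-entry moments.\<close>

lemma exp_moment_sum:
  fixes A :: "nat set"
  assumes D: "bandit_instance K D" and d: "d < K" and "finite A" "\<theta> \<noteq> 0"
  shows "(\<integral>\<^sup>+w. ennreal (exp (\<theta> * ((\<Sum>n\<in>A. w (d, n)) - real (card A) * arm_mean D d))) \<partial>table K D)
      \<le> ennreal (exp (\<theta>\<^sup>2 * card A / 8))"
proof -
  \<comment> \<open>outside the instance \<open>D\<close> is arbitrary, while the product lemmas want probability measures everywhere\<close>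
  define D' where "D' p = (if fst p < K then D (fst p) else return borel 0)" for p :: "nat \<times> nat"
  let ?J = "(\<lambda>n. (d, n)) ` A" and ?I = "{..<K} \<times> (UNIV :: nat set)"
  have "prob_space (D' p)" for p
    by (simp add: D'_def bandit_instanceD(1)[OF D] prob_space_return)
  then interpret product_prob_space D' ?I
    by (simp add: product_prob_space_def product_prob_space_axioms_def product_sigma_finite_def
      prob_space_imp_sigma_finite)
  have tab: "table K D = PiM ?I D'"
    unfolding table_def by (rule PiM_cong) (auto simp: D'_def)
  define g where "g = (\<lambda>x. ennreal (exp (\<theta> * (x - arm_mean D d))))"
  have g [measurable]: "g \<in> borel_measurable borel"
    by (simp add: g_def)
  have D'p: "p \<in> ?J \<Longrightarrow> D' p = D d" for p
    using d by (auto simp: D'_def)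
  have gD: "p \<in> ?J \<Longrightarrow> g \<in> borel_measurable (D' p)" for p
    using g by (simp add: D'p measurable_cong_sets[OF bandit_instanceD(2)[OF D d] refl])
  have J: "finite ?J" "?J \<subseteq> ?I"
    using d \<open>finite A\<close> by auto
  have prod_meas: "(\<lambda>w. \<Prod>p\<in>?J. g (w p)) \<in> borel_measurable (PiM ?J D')"
  proof (rule borel_measurable_prod_ennreal)
    fix p assume p: "p \<in> ?J"
    show "(\<lambda>w. g (w p)) \<in> borel_measurable (PiM ?J D')"
      by (rule measurable_compose[OF measurable_component_singleton[OF p, of D'] gD[OF p]])
  qed
  have "(\<integral>\<^sup>+w. ennreal (exp (\<theta> * ((\<Sum>n\<in>A. w (d, n)) - real (card A) * arm_mean D d))) \<partial>table K D)
      = (\<integral>\<^sup>+w. (\<Prod>p\<in>?J. g (restrict w ?J p)) \<partial>PiM ?I D')"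
    unfolding tab
  proof (rule nn_integral_cong)
    fix w :: "nat \<times> nat \<Rightarrow> real"
    have "\<theta> * ((\<Sum>n\<in>A. w (d, n)) - real (card A) * arm_mean D d) =
        (\<Sum>n\<in>A. \<theta> * (w (d, n) - arm_mean D d))"
      by (simp add: sum_distrib_left[symmetric] sum_subtractf)
    then have "exp (\<theta> * ((\<Sum>n\<in>A. w (d, n)) - real (card A) * arm_mean D d)) =
        (\<Prod>n\<in>A. exp (\<theta> * (w (d, n) - arm_mean D d)))"
      using \<open>finite A\<close> by (simp add: exp_sum)
    then show "ennreal (exp (\<theta> * ((\<Sum>n\<in>A. w (d, n)) - real (card A) * arm_mean D d))) =
        (\<Prod>p\<in>?J. g (restrict w ?J p))"
      by (simp add: prod.reindex inj_on_def g_def prod_ennreal)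
  qed
  also have "\<dots> = (\<integral>\<^sup>+w. (\<Prod>p\<in>?J. g (w p)) \<partial>distr (PiM ?I D') (PiM ?J D') (\<lambda>w. restrict w ?J))"
    using J prod_meas by (subst nn_integral_distr) (auto intro: measurable_restrict_subset)
  also have "\<dots> = (\<Prod>p\<in>?J. \<integral>\<^sup>+x. g x \<partial>D' p)"
    unfolding distr_PiM_restrict_finite[OF J]
    by (rule product_nn_integral_prod[OF J(1) gD])
  also have "\<dots> \<le> (\<Prod>p\<in>?J. ennreal (exp (\<theta>\<^sup>2 / 8)))"
    using exp_moment_entry[OF D d \<open>\<theta> \<noteq> 0\<close>] D'p by (intro prod_mono_ennreal) (simp add: g_def)
  also have "\<dots> = ennreal (exp (\<theta>\<^sup>2 * card A / 8))"
    by (simp add: card_image inj_on_def ennreal_power mult_ac flip: exp_of_nat_mult)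
  finally show ?thesis .
qed

lemma exp_moment_sum_integrable:
  fixes A :: "nat set"
  assumes D: "bandit_instance K D" and d: "d < K" and A: "finite A" "\<theta> \<noteq> 0"
  defines "F \<equiv> \<lambda>w. exp (\<theta> * ((\<Sum>n\<in>A. w (d, n)) - real (card A) * arm_mean D d))"
  shows "integrable (table K D) F" "(\<integral>w. F w \<partial>table K D) \<le> exp (\<theta>\<^sup>2 * card A / 8)"
proof -
  note [measurable] = measurable_entry[OF D]
  have meas: "F \<in> borel_measurable (table K D)"
    unfolding F_def by measurable
  have le: "(\<integral>\<^sup>+w. ennreal (F w) \<partial>table K D) \<le> ennreal (exp (\<theta>\<^sup>2 * card A / 8))"
    unfolding F_def by (rule exp_moment_sum[OF D d A])
  show int: "integrable (table K D) F"
    using meas le by (intro integrableI_nonneg) (auto simp: F_def intro: le_less_trans)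
  have "ennreal (\<integral>w. F w \<partial>table K D) = (\<integral>\<^sup>+w. ennreal (F w) \<partial>table K D)"
    using int by (intro nn_integral_eq_integral[symmetric]) (auto simp: F_def)
  then show "(\<integral>w. F w \<partial>table K D) \<le> exp (\<theta>\<^sup>2 * card A / 8)"
    using le by (metis ennreal_le_iff exp_ge_zero)
qed

text \<open>The maximum over \<open>B\<close> is handled through \<open>y \<le> a + exp (\<lambda> (y - a)) / \<lambda>\<close>, whose right-hand side
  is summed over \<open>B\<close>; \<open>\<lambda> = 4 a\<close> per sample minimises the resulting bound.\<close>
lemma uniform_deviation:
  fixes A :: "nat set" and B :: "nat set" and a :: real
  assumes D: "bandit_instance K D" and B: "finite B" "B \<subseteq> {..<K}" and "finite A" "0 < a"
    and large: "1 \<le> card A * a\<^sup>2" "card B \<le> exp (2 * (card A * a\<^sup>2))"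
  obtains \<delta> where "integrable (table K D) \<delta>" "(\<integral>w. \<delta> w \<partial>table K D) \<le> 2 * a"
    "\<And>w d. d \<in> B \<Longrightarrow> \<bar>(\<Sum>n\<in>A. w (d, n)) - real (card A) * arm_mean D d\<bar> \<le> real (card A) * \<delta> w"
proof -
  interpret prob_space "table K D" by (rule prob_space_table[OF D])
  define q where "q = real (card A)"
  define F where "F \<theta> d w = exp (\<theta> * ((\<Sum>n\<in>A. w (d, n)) - q * arm_mean D d))"
    for \<theta> d and w :: "nat \<times> nat \<Rightarrow> real"
  define G where "G d w = F (4 * a) d w + F (- (4 * a)) d w" for d and w :: "nat \<times> nat \<Rightarrow> real"
  \<comment> \<open>The factor exp(-\<lambda> q a) / (\<lambda> q) with \<lambda> = 4 a: the
    exponential bound on a sum of \<open>q\<close> samples, divided by \<open>q\<close>.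
    \<open>G\<close> contains both signs to control the absolute value.\<close>
  define c where "c = exp (- (4 * q * a\<^sup>2)) / (4 * q * a)"
  define \<delta> where "\<delta> w = a + c * (\<Sum>d\<in>B. G d w)" for w
  have "card A \<noteq> 0"
    using large(1) by (intro notI) simp
  then have q: "0 < q"
    unfolding q_def by linarith
  have c: "0 < c" using q \<open>0 < a\<close> by (simp add: c_def)
  have F: "integrable (table K D) (F \<theta> d)" "(\<integral>w. F \<theta> d w \<partial>table K D) \<le> exp (\<theta>\<^sup>2 * q / 8)"
    if "d \<in> B" "\<theta> \<noteq> 0" for \<theta> d
    using exp_moment_sum_integrable[OF D _ \<open>finite A\<close> that(2), of d] that B
    by (auto simp: F_def[abs_def] q_def)
  have G: "integrable (table K D) (G d)" "(\<integral>w. G d w \<partial>table K D) \<le> 2 * exp (2 * q * a\<^sup>2)"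
    if "d \<in> B" for d
    using F[OF that, of "4 * a"] F[OF that, of "- (4 * a)"] \<open>0 < a\<close>
    by (auto simp: G_def[abs_def] power_mult_distrib mult_ac)
  have G_pos: "0 \<le> G d w" for d w
    by (simp add: G_def F_def add_nonneg_nonneg)
  show ?thesis
  proof
    show "integrable (table K D) \<delta>"
      unfolding \<delta>_def using G by auto
    have "(\<integral>w. \<delta> w \<partial>table K D) = a + c * (\<Sum>d\<in>B. \<integral>w. G d w \<partial>table K D)"
      unfolding \<delta>_def using G
      by (subst Bochner_Integration.integral_add) (auto simp: prob_space)
    also have "(\<Sum>d\<in>B. \<integral>w. G d w \<partial>table K D) \<le> (\<Sum>d\<in>B. 2 * exp (2 * q * a\<^sup>2))"
      by (intro sum_mono G)
    also have "\<dots> \<le> exp (2 * (q * a\<^sup>2)) * (2 * exp (2 * q * a\<^sup>2))"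
      using large(2) by (simp add: q_def)
    \<comment> \<open>The size of \<open>B\<close> and the moment bound each contribute at most
      exp(2 q a^2), cancelling the exp(-4 q a^2) in \<open>c\<close>.\<close>
    also have "a + c * \<dots> = a + a / (2 * (q * a\<^sup>2))"
      using q \<open>0 < a\<close>
      by (simp add: c_def field_simps power2_eq_square flip: exp_add)
    also have "a / (2 * (q * a\<^sup>2)) \<le> a"
      using large(1) \<open>0 < a\<close> by (simp add: q_def divide_le_eq)
    finally show "(\<integral>w. \<delta> w \<partial>table K D) \<le> 2 * a"
      using c by (simp add: mult_left_mono)
  next
    fix w :: "nat \<times> nat \<Rightarrow> real" and d assume d: "d \<in> B"
    define e where "e = (\<Sum>n\<in>A. w (d, n)) - q * arm_mean D d"
    have bound: "z \<le> q * \<delta> w" if "exp (4 * a * z) \<le> G d w" for z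
    proof -
      have "4 * a * (z - q * a) \<le> exp (4 * a * (z - q * a))"
        using exp_ge_add_one_self[of "4 * a * (z - q * a)"] by linarith
      also have "\<dots> = exp (- (4 * q * a\<^sup>2)) * exp (4 * a * z)"
        by (simp add: algebra_simps power2_eq_square flip: exp_add)
      also have "\<dots> \<le> exp (- (4 * q * a\<^sup>2)) * (\<Sum>d\<in>B. G d w)"
        using that member_le_sum[OF d, of "\<lambda>d. G d w"] B(1) G_pos
        by (intro mult_left_mono) auto
      also have "\<dots> = 4 * a * (q * (c * (\<Sum>d\<in>B. G d w)))"
        using q \<open>0 < a\<close> by (simp add: c_def)
      finally have "z - q * a \<le> q * (c * (\<Sum>d\<in>B. G d w))"
        using \<open>0 < a\<close> by simp
      then show ?thesis
        by (simp add: \<delta>_def algebra_simps)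
    qed
    have "G d w = exp (4 * a * e) + exp (4 * a * - e)"
      by (simp add: G_def F_def flip: e_def)
    then have "e \<le> q * \<delta> w" "- e \<le> q * \<delta> w"
      by (intro bound; simp)+
    then show "\<bar>(\<Sum>n\<in>A. w (d, n)) - real (card A) * arm_mean D d\<bar> \<le> real (card A) * \<delta> w"
      by (simp add: e_def q_def)
  qed
qed

section \<open>Expected regret of the tournament\<close>

context tournament
begin

text \<open>The position is independent of the table, so at each time the branch of
  \<open>step\<close> is fixed and only the comparison of scores is random.\<close>

lemma state_measurable:
  assumes D: "bandit_instance K D"
  shows "(\<lambda>w. cur (state w t)) \<in> measurable (table K D) (count_space UNIV)"
    and "(\<lambda>w. acc (state w t)) \<in> borel_measurable (table K D)"
    and "(\<lambda>w. champ (state w t) l) \<in> measurable (table K D) (count_space UNIV)"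
    and "(\<lambda>w. score (state w t) l) \<in> borel_measurable (table K D)"
proof (induction t arbitrary: l)
  case 0
  {
    case 1 show ?case by simp
  next
    case 2 show ?case by (simp add: init_def)
  next
    case 3 show ?case by (simp add: init_def)
  next
    case 4 show ?case by (simp add: init_def)
  }
next
  case (Suc t)
  obtain j l k where p: "pos t = (j, l, k)"
    by (cases "pos t")
  note cur [measurable] = Suc(1)
  note acc [measurable] = Suc(2)
  note ch [measurable] = Suc(3)
  note sc [measurable] = Suc(4)
  note entry = measurable_entry[OF D]
  define x where "x w = acc (state w t) + w (cur (state w t), slot (pos t))" for w
  define keep where "keep w \<longleftrightarrow> champ (state w t) l \<noteq> None \<and> x w \<le> score (state w t) l" for w
  define c where "c w = (if keep w then the (champ (state w t) l) else cur (state w t))" for w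
  define y where "y w = (if keep w then score (state w t) l else x w)" for w
  \<comment> \<open>The entry is read at a random arm, but the arm ranges over a countable set and
    each fixed entry is measurable.\<close>
  have "(\<lambda>w. w (cur (state w t), slot (pos t))) \<in> borel_measurable (table K D)"
    using measurable_compose_countable[OF entry cur, of "\<lambda>a. (a, slot (pos t))"] .
  then have x [measurable]: "x \<in> borel_measurable (table K D)"
    unfolding x_def using acc by (intro borel_measurable_add)
  have "(\<lambda>w. champ (state w t) l \<noteq> None) \<in> measurable (table K D) (count_space UNIV)"
       "(\<lambda>w. the (champ (state w t) l)) \<in> measurable (table K D) (count_space UNIV)"
    by (rule measurable_compose[OF ch]; simp)+
  note [measurable] = this
  have [measurable]: "Measurable.pred (table K D) (\<lambda>w. x w \<le> score (state w t) l)"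
    unfolding pred_def by (rule borel_measurable_le[OF x sc])
  have keep [measurable]: "Measurable.pred (table K D) keep"
    unfolding keep_def by measurable
  have c [measurable]: "c \<in> measurable (table K D) (count_space UNIV)"
    unfolding c_def by measurable
  have "(\<lambda>w. Some (c w)) \<in> measurable (table K D) (count_space UNIV)"
    by (rule measurable_compose[OF c]) simp
  note [measurable] = this
  have y [measurable]: "y \<in> borel_measurable (table K D)"
    unfolding y_def by measurable
  have st: "state w (Suc t) =
      (if L \<le> l \<or> Suc k < s l then State (cur (state w t)) (x w) (champ (state w t)) (score (state w t))
       else if ends (Suc l) j then State (c w) 0 ((champ (state w t))(l := None)) (score (state w t))
       else State (Suc j) 0 ((champ (state w t))(l := Some (c w))) ((score (state w t))(l := y w)))" for w
    by (simp add: p x_def c_def y_def keep_def Let_def)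
  {
    case 1 show ?case
      unfolding st using cur c by (cases "L \<le> l \<or> Suc k < s l"; cases "ends (Suc l) j"; simp)
  next
    case 2 show ?case
      unfolding st using acc x by (cases "L \<le> l \<or> Suc k < s l"; cases "ends (Suc l) j"; simp)
  next
    case (3 l') show ?case
      unfolding st using ch
      by (cases "L \<le> l \<or> Suc k < s l"; cases "ends (Suc l) j"; cases "l' = l"; simp)
  next
    case (4 l') show ?case
      unfolding st using sc y
      by (cases "L \<le> l \<or> Suc k < s l"; cases "ends (Suc l) j"; cases "l' = l"; simp)
  }
qed

lemma regret_strategy:
  "regret K T D strategy (w, u) = (\<Sum>t<T. opt_mean K D - arm_mean D (cur (state w t)))"
  by (simp add: regret_def run_strategy sum_subtractf)

lemma card_block: "card {d. d < K \<and> d div N l = b} \<le> N l"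
proof -
  have "{d. d < K \<and> d div N l = b} \<subseteq> {b * N l..<b * N l + N l}"
    using N_pos[of l] by (auto simp: dividend_less_div_times add.commute[of _ "N l"])
  from card_mono[OF _ this] show ?thesis by simp
qed

text \<open>An exploration step costs at most 1, a commitment step at most the sum of
  \<open>2 * \<delta> l\<close>. Here \<open>a l\<close> is the accuracy of level \<open>l\<close>,
  and the expectation of \<open>\<delta> l\<close> is at most \<open>2 * a l\<close>.\<close>

lemma expected_regret:
  fixes a :: "nat \<Rightarrow> real"
  assumes D: "bandit_instance K D"
    and a: "\<And>l. l < L \<Longrightarrow> 0 < a l" "\<And>l. l < L \<Longrightarrow> 1 \<le> s l * (a l)\<^sup>2"
      "\<And>l. l < L \<Longrightarrow> real (N (Suc l)) \<le> exp (2 * (s l * (a l)\<^sup>2))"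
  shows "regret K T D strategy \<in> borel_measurable (reward_space K D)"
    and "(\<integral>x. regret K T D strategy x \<partial>reward_space K D)
      \<le> real (\<Sum>l<L. s l * card {j. j < K \<and> ends l j}) + real T * (\<Sum>l<L. 4 * a l)"
proof -
  let ?M = "table K D"
  let ?U = "uniform_measure lborel {0..1::real}"
  interpret M: prob_space ?M by (rule prob_space_table[OF D])
  interpret U: prob_space ?U by (rule prob_space_uniform_measure) auto
  define g where "g w = (\<Sum>t<T. opt_mean K D - arm_mean D (cur (state w t)))" for w
  have g: "g \<in> borel_measurable ?M"
    unfolding g_def
    by (intro borel_measurable_sum borel_measurable_diff borel_measurable_const
        measurable_compose[OF state_measurable(1)[OF D], of "arm_mean D"]) simp
  have rs: "reward_space K D = ?M \<Otimes>\<^sub>M ?U"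
    by (simp add: reward_space_def table_def)
  have reg: "regret K T D strategy = (\<lambda>x. g (fst x))"
    by (auto simp: regret_strategy g_def)
  show "regret K T D strategy \<in> borel_measurable (reward_space K D)"
    unfolding rs reg by (rule measurable_compose[OF measurable_fst g])
  obtain best where best: "best < K" "arm_mean D best = opt_mean K D"
    using opt_mean_attained[OF K_pos] .
  have cur_lt: "cur (state w t) < K" for w t
    using invariant[of w t] pos_valid[of t] by (cases "pos t") (auto simp: invariant_def Let_def)
  have gap: "0 \<le> opt_mean K D - arm_mean D (cur (state w t))"
    "opt_mean K D - arm_mean D (cur (state w t)) \<le> 1" for w t
    using arm_mean_le_opt[OF cur_lt, of D w t] arm_mean_bounds[OF D best(1)]
      arm_mean_bounds[OF D cur_lt[of w t]] best(2) by auto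
  have "\<exists>\<delta>. l < L \<longrightarrow> integrable ?M \<delta> \<and> (\<integral>w. \<delta> w \<partial>?M) \<le> 2 * a l \<and>
      (\<forall>w d. d < K \<and> d div N (Suc l) = best div N (Suc l) \<longrightarrow>
        \<bar>(\<Sum>n<s l. w (d, offset l + n)) - real (s l) * arm_mean D d\<bar> \<le> real (s l) * \<delta> w)" for l
  proof (cases "l < L")
    case True
    \<comment> \<open>\<open>A\<close> holds the table columns read at level \<open>l\<close>, the
      same for every arm; \<open>B\<close> is the whole level \<open>Suc l\<close> batch of
      \<open>best\<close>, whichever arms win.\<close>
    define A where "A = (\<lambda>n. offset l + n) ` {..<s l}"
    define B where "B = {d. d < K \<and> d div N (Suc l) = best div N (Suc l)}"
    have A: "finite A" "card A = s l" "(\<Sum>n\<in>A. f n) = (\<Sum>n<s l. f (offset l + n))"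
      for f :: "nat \<Rightarrow> real"
      by (auto simp: A_def card_image inj_on_def sum.reindex)
    have "real (card B) \<le> real (N (Suc l))"
      using card_block[of "Suc l"] by (simp add: B_def)
    also note a(3)[OF True]
    finally have "real (card B) \<le> exp (2 * (card A * (a l)\<^sup>2))"
      by (simp add: A)
    moreover have "finite B" "B \<subseteq> {..<K}"
      by (auto simp: B_def)
    ultimately obtain \<delta> where "integrable ?M \<delta>" "(\<integral>w. \<delta> w \<partial>?M) \<le> 2 * a l"
      "\<And>w d. d \<in> B \<Longrightarrow> \<bar>(\<Sum>n\<in>A. w (d, n)) - real (card A) * arm_mean D d\<bar> \<le> real (card A) * \<delta> w"
      using uniform_deviation[OF D _ _ A(1) a(1)[OF True], of B] a(2)[OF True] A(2) by metis
    then show ?thesis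
      by (intro exI[of _ \<delta>]) (auto simp: A B_def)
  qed auto
  then obtain \<delta> where \<delta>: "\<And>l. l < L \<Longrightarrow> integrable ?M (\<delta> l)"
    "\<And>l. l < L \<Longrightarrow> (\<integral>w. \<delta> l w \<partial>?M) \<le> 2 * a l"
    "\<And>l w d. l < L \<Longrightarrow> d < K \<Longrightarrow> d div N (Suc l) = best div N (Suc l) \<Longrightarrow>
        \<bar>(\<Sum>n<s l. w (d, offset l + n)) - real (s l) * arm_mean D d\<bar> \<le> real (s l) * \<delta> l w"
    by metis
  have \<delta>_nonneg: "0 \<le> \<delta> l w" if "l < L" for l w
  proof -
    have "0 \<le> real (s l) * \<delta> l w"
      by (rule order_trans[OF abs_ge_zero \<delta>(3)[OF that best(1) refl]])
    then show ?thesis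
      using s_pos[of l] by (simp add: zero_le_mult_iff)
  qed
  define E where "E = real (\<Sum>l<L. s l * card {j. j < K \<and> ends l j})"
  have g_le: "g w \<le> E + real T * (\<Sum>l<L. 2 * \<delta> l w)" for w
  proof -
    have "opt_mean K D - arm_mean D (cur (state w t)) \<le>
        of_bool (exploring t) + (\<Sum>l<L. 2 * \<delta> l w)" for t
    proof (cases "exploring t")
      case True
      have "0 \<le> (\<Sum>l<L. 2 * \<delta> l w)"
        using \<delta>_nonneg by (intro sum_nonneg) auto
      then show ?thesis using gap[of w t] True by simp
    next
      case False
      then obtain j k where "pos t = (j, L, k)"
        using pos_valid[of t] by (cases "pos t") (auto simp: exploring_def)
      have "arm_mean D best - (\<Sum>l<L. 2 * \<delta> l w) \<le> arm_mean D (cur (state w t))"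
        by (rule winner_near_optimal[OF best(1) \<delta>(3) \<open>pos t = (j, L, k)\<close>])
      then show ?thesis
        using best(2) False by simp
    qed
    then have "g w \<le> (\<Sum>t<T. of_bool (exploring t) + (\<Sum>l<L. 2 * \<delta> l w))"
      unfolding g_def by (intro sum_mono)
    also have "\<dots> = real (card {t. t < T \<and> exploring t}) + real T * (\<Sum>l<L. 2 * \<delta> l w)"
      by (simp add: sum.distrib sum.If_cases of_bool_def Int_def)
    also have "real (card {t. t < T \<and> exploring t}) \<le> E"
      unfolding E_def using card_exploring[of T] by (simp only: of_nat_le_iff)
    finally show ?thesis by simp
  qed
  have g_int: "integrable ?M g"
  proof (rule M.integrable_const_bound)
    have "\<bar>g w\<bar> \<le> real T" for w
    proof -
      have "\<bar>g w\<bar> \<le> (\<Sum>t<T. \<bar>opt_mean K D - arm_mean D (cur (state w t))\<bar>)"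
        unfolding g_def by (rule sum_abs)
      also have "\<dots> \<le> (\<Sum>t<T. 1)"
        using gap[of w] by (intro sum_mono) simp
      finally show ?thesis by simp
    qed
    then show "AE w in ?M. norm (g w) \<le> real T" by simp
  qed (rule g)
  have sum_int: "integrable ?M (\<lambda>w. \<Sum>l<L. 2 * \<delta> l w)"
    using \<delta>(1) by (intro Bochner_Integration.integrable_sum integrable_mult_right) auto
  have "(\<integral>x. regret K T D strategy x \<partial>reward_space K D) =
      (\<integral>w. g w \<partial>distr (?M \<Otimes>\<^sub>M ?U) ?M fst)"
    unfolding rs reg using g by (intro integral_distr[symmetric]) auto
  \<comment> \<open>The strategy ignores its seed, which integrates out.\<close>
  also have "\<dots> = (\<integral>w. g w \<partial>?M)"
    by (simp add: U.distr_pair_fst)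
  also have "\<dots> \<le> (\<integral>w. E + real T * (\<Sum>l<L. 2 * \<delta> l w) \<partial>?M)"
    by (intro integral_mono g_int g_le Bochner_Integration.integrable_add integrable_mult_right
        sum_int M.integrable_const)
  also have "\<dots> = E + real T * (\<Sum>l<L. 2 * (\<integral>w. \<delta> l w \<partial>?M))"
    using \<delta>(1) sum_int by (simp add: M.prob_space Bochner_Integration.integral_sum)
  also have "\<dots> \<le> E + real T * (\<Sum>l<L. 4 * a l)"
    using \<delta>(2) by (intro add_left_mono mult_left_mono sum_mono) fastforce+
  finally show "(\<integral>x. regret K T D strategy x \<partial>reward_space K D)
      \<le> real (\<Sum>l<L. s l * card {j. j < K \<and> ends l j}) + real T * (\<Sum>l<L. 4 * a l)"
    by (simp add: E_def)
qed

end

section \<open>Power towers and the choice of parameters\<close>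

fun tower :: "nat \<Rightarrow> nat" where
  "tower 0 = 1"
| "tower (Suc n) = 2 ^ tower n"

lemma tower_ge: "Suc n \<le> tower n"
proof (induction n)
  case (Suc n)
  have "Suc (tower n) \<le> 2 ^ tower n"
    by (simp add: Suc_le_eq)
  then show ?case using Suc by simp
qed simp

lemma tower_dvd_Suc: "tower n dvd tower (Suc n)"
proof (induction n)
  case (Suc n)
  have "tower n \<le> tower (Suc n)"
    by simp
  then show ?case
    by (simp add: le_imp_power_dvd)
qed simp

text \<open>The tower inverts the iterated logarithm. For \<open>x \<le> 0\<close>, where the
  logarithm carries no information, the bound is trivial.\<close>

lemma funpow_log2_le_1:
  "((\<lambda>y. log 2 y) ^^ i) x \<le> 1 \<Longrightarrow> x \<le> real (tower i)"
proof (induction i arbitrary: x)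
  case (Suc i)
  have "((\<lambda>y. log 2 y) ^^ i) (log 2 x) \<le> 1"
    using Suc.prems by (simp add: funpow_swap1)
  then have le: "log 2 x \<le> real (tower i)"
    by (rule Suc.IH)
  show ?case
  proof (cases "0 < x")
    case True
    then show ?thesis
      using le by (simp add: log_le_iff powr_realpow)
  next
    case False
    then have "x \<le> 0" by simp
    also have "0 \<le> real (tower (Suc i))" by (rule of_nat_0_le_iff)
    finally show ?thesis .
  qed
qed simp

text \<open>Guarantees that the \<open>LEAST\<close> in \<open>log_star\<close> is attained.\<close>

lemma ex_funpow_log2_le_1:
  "x \<le> real (tower n) \<Longrightarrow> \<exists>i. ((\<lambda>y. log 2 y) ^^ i) x \<le> 1"
proof (induction n arbitrary: x)
  case 0
  then show ?case by (intro exI[of _ 0]) simp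
next
  case (Suc n)
  show ?case
  proof (cases "x \<le> 1")
    case True
    then show ?thesis by (intro exI[of _ 0]) simp
  next
    case False
    then have "log 2 x \<le> real (tower n)"
      using Suc.prems by (simp add: log_le_iff powr_realpow)
    from Suc.IH[OF this] obtain i where "((\<lambda>y. log 2 y) ^^ i) (log 2 x) \<le> 1" ..
    then show ?thesis
      by (intro exI[of _ "Suc i"]) (simp add: funpow_swap1)
  qed
qed

lemma le_tower_log_star: "K \<le> tower (log_star (real K))"
proof -
  have "real K \<le> real (tower K)"
    using tower_ge[of K] by linarith
  from ex_funpow_log2_le_1[OF this]
  have "((\<lambda>y. log 2 y) ^^ log_star (real K)) (real K) \<le> 1"
    unfolding log_star_def by (rule LeastI_ex)
  from funpow_log2_le_1[OF this] show ?thesis by simp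
qed

lemma sum_halves_le: "(\<Sum>l<n. (1 / 2 :: real) ^ l) \<le> 2"
proof -
  have "(\<Sum>l<n. (1 / 2 :: real) ^ l) = 2 - 2 * (1 / 2) ^ n"
    by (induction n) auto
  then show ?thesis by simp
qed

text \<open>The reason for using towers: a level \<open>Suc l\<close> batch has size 2 to a power of
  order \<open>tower l\<close>, because \<open>Suc l \<le> tower l\<close> absorbs the factor
  \<open>8 ^ Suc l\<close>.\<close>

lemma batch_le_exp: "real (8 ^ Suc l * tower (Suc l)) \<le> exp (2 * (4 * real (tower l)))"
proof -
  have "8 ^ Suc l * tower (Suc l) = 2 ^ (3 * Suc l + tower l)"
    by (simp only: tower.simps power_add power_mult) simp
  then have "real (8 ^ Suc l * tower (Suc l)) = 2 ^ (3 * Suc l + tower l)"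
    by (metis of_nat_numeral of_nat_power)
  also have "\<dots> \<le> exp 1 ^ (3 * Suc l + tower l)"
    using exp_ge_add_one_self[of 1] by (intro power_mono) auto
  also have "\<dots> = exp (real (3 * Suc l + tower l))"
    by (simp flip: exp_of_nat_mult)
  also have "3 * Suc l + tower l \<le> 8 * tower l"
    using tower_ge[of l] by simp
  then have "exp (real (3 * Suc l + tower l)) \<le> exp (real (8 * tower l))"
    by (simp only: exp_le_cancel_iff of_nat_le_iff)
  finally show ?thesis by simp
qed

theorem theorem5p6:
  shows "\<exists>C::real. \<forall>K T::nat. 1 \<le> K \<longrightarrow> K < T \<longrightarrow>
           (\<exists>alg.
              (\<forall>w s. mem_feasible (log_star (real K) + 1) K
                        (map (\<lambda>x. (fst x, fst (snd x))) (run alg w s T))) \<and>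
              (\<forall>D. bandit_instance K D \<longrightarrow>
                   regret K T D alg \<in> borel_measurable (reward_space K D) \<and>
                   (\<integral>x. regret K T D alg x \<partial>reward_space K D)
                      \<le> C * real K powr (1/3) * real T powr (2/3)))"
\<comment> \<open>72 = 64 + 8: exploration, and \<open>T\<close> times the loss of the committed
  arm.\<close>
proof (intro exI[of _ 72] allI impI)
  fix K T :: nat
  assume K: "1 \<le> K" and KT: "K < T"
  \<comment> \<open>This value balances the exploration cost \<open>K * x\<close> against the
    commitment loss \<open>T / sqrt x\<close>; both become K^(1/3) T^(2/3).\<close>
  define x where "x = (real T / real K) powr (2/3)"
  define m where "m = nat \<lfloor>x\<rfloor>"
  define N where "N l = 8 ^ l * tower l" for l
  \<comment> \<open>Taking the least level keeps \<open>N l < K\<close> below \<open>L\<close>,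
    which later absorbs the extra one in \<open>card_ends\<close>.\<close>
  define L where "L = (LEAST l. K \<le> N l)"
  define s where "s l = 4 ^ (l + 2) * tower l * m" for l
  \<comment> \<open>Chosen so that \<open>s l\<close> times the square of \<open>a l\<close> is
    \<open>4 * tower l\<close>, matching \<open>batch_le_exp\<close>, while \<open>a l\<close> still
    halves from level to level.\<close>
  define a where "a l = 1 / (2 ^ Suc l * sqrt m)" for l
  have tower_pos: "0 < tower l" for l
    using tower_ge[of l] by simp
  have "1 \<le> x"
    unfolding x_def using K KT by (intro ge_one_powr_ge_zero) auto
  then have m: "0 < m" "real m \<le> x" "x < real m + 1"
    unfolding m_def by linarith+
  then have m2: "x \<le> 2 * real m"
    by linarith
  have "tower (log_star (real K)) \<le> N (log_star (real K))"
    by (simp add: N_def)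
  then have ex: "K \<le> N (log_star (real K))"
    using le_tower_log_star[of K] by linarith
  have L: "K \<le> N L" "L \<le> log_star (real K)" "\<And>l. l < L \<Longrightarrow> N l < K"
    unfolding L_def using LeastI[of "\<lambda>l. K \<le> N l", OF ex] Least_le[of "\<lambda>l. K \<le> N l", OF ex]
    by (auto dest: not_less_Least)
  interpret tournament K L N s
  proof
    show "N l dvd N (Suc l)" for l
      unfolding N_def using tower_dvd_Suc[of l] by (intro mult_dvd_mono le_imp_power_dvd) auto
  qed (use K L m tower_pos in \<open>auto simp: N_def s_def\<close>)
  have sa: "real (s l) * (a l)\<^sup>2 = 4 * real (tower l)" for l
  proof -
    have "(4::real) ^ l = (2 ^ l)\<^sup>2"
      by (simp add: power2_eq_square flip: power_mult_distrib)
    then show ?thesis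
      using m(1) by (simp add: s_def a_def power_mult_distrib power_divide field_simps)
  qed
  have sN: "real (s l) / real (N l) = 16 * real m * (1 / 2) ^ l" for l
  proof -
    have "(4::real) ^ l / 8 ^ l = (1 / 2) ^ l"
      by (simp flip: power_divide)
    then show ?thesis
      using tower_pos[of l] by (simp add: s_def N_def field_simps)
  qed
  have "real (\<Sum>l<L. s l * card {j. j < K \<and> ends l j}) \<le> (\<Sum>l<L. 32 * K * m * (1 / 2) ^ l)"
    unfolding of_nat_sum
  proof (rule sum_mono)
    fix l assume "l \<in> {..<L}"
    then have l: "real (N l) \<le> real K" "0 < real (N l)"
      using L(3)[of l] N_pos[of l] by auto
    have "real (card {j. j < K \<and> ends l j}) \<le> real (K div N l + 1)"
      using card_ends[of l] by (simp only: of_nat_le_iff)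
    \<comment> \<open>As \<open>N l \<le> K\<close>, the incomplete batch at most doubles the
      count.\<close>
    also have "\<dots> \<le> 2 * K / N l"
      using l of_nat_div_le_of_nat[of K "N l", where ?'a = real] by (simp add: field_simps)
    finally have "real (s l) * real (card {j. j < K \<and> ends l j}) \<le> real (s l) * (2 * K / N l)"
      by (rule mult_left_mono) simp
    also have "\<dots> = 2 * K * (real (s l) / real (N l))"
      by simp
    finally show "real (s l * card {j. j < K \<and> ends l j}) \<le> 32 * K * m * (1 / 2) ^ l"
      by (simp add: sN mult_ac)
  qed
  also have "\<dots> = 32 * K * m * (\<Sum>l<L. (1 / 2) ^ l)"
    by (simp add: sum_distrib_left)
  also have "\<dots> \<le> real (32 * K * m) * 2"
    using sum_halves_le by (intro mult_left_mono) auto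
  also have "\<dots> \<le> 64 * (K * x)"
    using m(2) K by simp
  also have "K * x = real K powr (1/3) * real T powr (2/3)"
    using K powr_diff[of "real K" 1 "2/3"] by (simp add: x_def powr_divide)
  finally have cost: "real (\<Sum>l<L. s l * card {j. j < K \<and> ends l j}) \<le>
      64 * (real K powr (1/3) * real T powr (2/3))" .
  \<comment> \<open>Rounding \<open>x\<close> down to \<open>m\<close> costs at most a factor 2,
    since \<open>x \<ge> 1\<close>.\<close>
  have "sqrt x \<le> 2 * sqrt m"
  proof -
    have "sqrt x \<le> sqrt (2\<^sup>2 * m)"
      using m2 by (intro real_sqrt_le_mono) simp
    then show ?thesis
      by (simp add: real_sqrt_mult)
  qed
  moreover have "0 < sqrt x" using \<open>1 \<le> x\<close> by simp
  ultimately have sqrt_m: "1 / sqrt m \<le> 2 / sqrt x"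
    using m(1) by (simp add: field_simps)
  have sqrt_x: "sqrt x = (real T / real K) powr (1/3)"
    using \<open>1 \<le> x\<close> by (simp add: powr_half_sqrt[symmetric]) (simp add: x_def powr_powr)
  have "(\<Sum>l<L. 4 * a l) = 2 * (1 / sqrt m) * (\<Sum>l<L. (1 / 2) ^ l)"
    unfolding sum_distrib_left by (intro sum.cong) (auto simp: a_def field_simps)
  also have "\<dots> \<le> 2 * (2 / sqrt x) * 2"
    using sum_halves_le sqrt_m \<open>1 \<le> x\<close> by (intro mult_mono sum_nonneg) auto
  finally have "real T * (\<Sum>l<L. 4 * a l) \<le> real T * (8 / sqrt x)"
    by (intro mult_left_mono) auto
  also have "real T * (8 / sqrt x) = 8 * (real K powr (1/3) * real T powr (2/3))"
    using K KT powr_diff[of "real T" 1 "1/3"] by (simp add: sqrt_x powr_divide)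
  finally have err: "real T * (\<Sum>l<L. 4 * a l) \<le> 8 * (real K powr (1/3) * real T powr (2/3))" .
  show "\<exists>alg.
      (\<forall>w s. mem_feasible (log_star (real K) + 1) K
                (map (\<lambda>x. (fst x, fst (snd x))) (run alg w s T))) \<and>
      (\<forall>D. bandit_instance K D \<longrightarrow>
           regret K T D alg \<in> borel_measurable (reward_space K D) \<and>
           (\<integral>x. regret K T D alg x \<partial>reward_space K D)
              \<le> 72 * real K powr (1/3) * real T powr (2/3))"
  proof (intro exI[of _ strategy] conjI allI impI)
    show "mem_feasible (log_star (real K) + 1) K
        (map (\<lambda>x. (fst x, fst (snd x))) (run strategy w u T))" for w u
      using L(2) by (intro strategy_feasible) simp
    fix D assume D: "bandit_instance K D"
    have a_pos: "0 < a l" for l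
      using m(1) by (simp add: a_def)
    have sa_ge: "1 \<le> real (s l) * (a l)\<^sup>2" for l
      using tower_ge[of l] unfolding sa by linarith
    have batch: "real (N (Suc l)) \<le> exp (2 * (real (s l) * (a l)\<^sup>2))" for l
      unfolding sa N_def by (rule batch_le_exp)
    note R = expected_regret[OF D a_pos sa_ge batch, of T]
    show "regret K T D strategy \<in> borel_measurable (reward_space K D)"
      by (rule R)
    show "(\<integral>x. regret K T D strategy x \<partial>reward_space K D)
        \<le> 72 * real K powr (1/3) * real T powr (2/3)"
      using R(2) cost err by simp
  qed
qed

end
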